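(* Let $k \in \omega$ with $k \geq 1$. Then \[ \lim_{n \to \infty}\frac{\left|\{\mathcal{G} \in \mathbb{G}_{k}(n) : (\exists \mathcal{H} \in \mathbb{G}_{k-1}(n))\ \mathcal{G} \cong \mathcal{H}\}\right|}{\left|\mathbb{G}_{k}(n)\right|} = 0. \]
   Context: Notation: $\omega=\{0,1,2,\dots\}$ and $[m]=\{0,1,\dots,m-1\}$; $\mathcal{P}(Z)$ is the power set of $Z$. Graphs are simple undirected graphs. For $k,n\in\omega$, a $k$-rainbow sequence on $[n]$ is a pair $S=(a,e)$ of functions $a:[n]\to[k]$ and $e:[n]\to\mathcal{P}([k])$. The graph associated with $S$ is the graph on vertex set $[n]$ in which, for all $x<y$ in $[n]$, $x$ and $y$ are adjacent if and only if $a(x)\in e(y)$. $\mathbb{G}_k(n)$ denotes the set of all (labelled) graphs on vertex set $[n]$ that are associated with some $k$-rainbow sequence on $[n]$ (the $k$-rainbow threshold graphs on $[n]$). $\cong$ denotes graph isomorphism. *)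

theory Defs
  imports
    Complex_Main
    "HOL-Library.FuncSet"
    "Graph_Theory.Pair_Digraph"
    "Graph_Theory.Digraph_Isomorphism"
begin

text \<open>
  The sets $[n]$ and $[k]$ are \<^term>\<open>{..<n}\<close> and \<^term>\<open>{..<k}\<close>. Extensional function spaces make
  \<^term>\<open>a\<close> and \<^term>\<open>e\<close> honest functions with domain $[n]$.
\<close>

definition rainbow_sequences :: "nat \<Rightarrow> nat \<Rightarrow> ((nat \<Rightarrow> nat) \<times> (nat \<Rightarrow> nat set)) set" where
  "rainbow_sequences k n = ({..<n} \<rightarrow>\<^sub>E {..<k}) \<times> ({..<n} \<rightarrow>\<^sub>E Pow {..<k})"

text \<open>
  As usual in the library, a simple undirected graph is a loop-free symmetric digraph
  (\<^locale>\<open>pair_graph\<close>): the edge between \<^term>\<open>x\<close> and \<^term>\<open>y\<close> is the pair of arcs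
  \<^term>\<open>(x, y)\<close> and \<^term>\<open>(y, x)\<close>.
\<close>

definition rainbow_graph :: "nat \<Rightarrow> (nat \<Rightarrow> nat) \<times> (nat \<Rightarrow> nat set) \<Rightarrow> nat pair_pre_digraph" where
  "rainbow_graph n = (\<lambda>(a, e).
     \<lparr> pverts = {..<n},
       parcs = {(x, y). x < n \<and> y < n \<and> (x < y \<and> a x \<in> e y \<or> y < x \<and> a y \<in> e x)} \<rparr>)"

definition rainbow_threshold_graphs :: "nat \<Rightarrow> nat \<Rightarrow> nat pair_pre_digraph set" where
  "rainbow_threshold_graphs k n = rainbow_graph n ` rainbow_sequences k n"

abbreviation graph_iso :: "'a pair_pre_digraph \<Rightarrow> 'b pair_pre_digraph \<Rightarrow> bool" (infix \<open>\<cong>\<^sub>g\<close> 50) where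
  "G \<cong>\<^sub>g H \<equiv> digraph_iso (with_proj G) (with_proj H)"

lemma rainbow_graph_pair_graph: "pair_graph (rainbow_graph n S)"
proof -
  obtain a e where S: "S = (a, e)" by (cases S)
  have "parcs (rainbow_graph n S) \<subseteq> {..<n} \<times> {..<n}"
    by (auto simp: S rainbow_graph_def)
  then have "finite (parcs (rainbow_graph n S))"
    by (rule finite_subset) simp
  then show ?thesis
    by unfold_locales (auto simp: S rainbow_graph_def symmetric_def intro!: symI)
qed

lemma rainbow_graph_adjacent_iff:
  assumes "x < y" "y < n"
  shows "(x, y) \<in> parcs (rainbow_graph n (a, e)) \<longleftrightarrow> a x \<in> e y"
    and "(y, x) \<in> parcs (rainbow_graph n (a, e)) \<longleftrightarrow> a x \<in> e y"
  using assms by (auto simp: rainbow_graph_def)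

lemma finite_rainbow_threshold_graphs: "finite (rainbow_threshold_graphs k n)"
  by (auto simp: rainbow_threshold_graphs_def rainbow_sequences_def intro!: finite_PiE)

lemma rainbow_threshold_graphs_nonempty:
  assumes "k \<ge> 1"
  shows "rainbow_threshold_graphs k n \<noteq> {}"
  using assms
  by (auto simp: rainbow_threshold_graphs_def rainbow_sequences_def PiE_eq_empty_iff lessThan_empty_iff)

text \<open>On graphs, the library's isomorphism is the usual one: an adjacency-preserving bijection.\<close>

lemma graph_iso_iff:
  assumes "pair_wf_digraph G" "pair_wf_digraph H"
  shows "G \<cong>\<^sub>g H \<longleftrightarrow>
    (\<exists>f. bij_betw f (pverts G) (pverts H) \<and>
      (\<forall>x\<in>pverts G. \<forall>y\<in>pverts G. (x, y) \<in> parcs G \<longleftrightarrow> (f x, f y) \<in> parcs H))"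
proof -
  interpret G: pair_wf_digraph G by fact
  interpret H: pair_wf_digraph H by fact
  show ?thesis
  proof
    assume "G \<cong>\<^sub>g H"
    then obtain h where h: "pre_digraph.digraph_isomorphism (with_proj G) h"
      and H: "with_proj H = app_iso h (with_proj G)"
      by (auto simp: digraph_iso_def)
    let ?f = "iso_verts h"
    have inj: "inj_on ?f (pverts G)"
      and tl: "\<And>a. a \<in> parcs G \<Longrightarrow> ?f (fst a) = iso_tail h (iso_arcs h a)"
      and hd: "\<And>a. a \<in> parcs G \<Longrightarrow> ?f (snd a) = iso_head h (iso_arcs h a)"
      using h by (auto simp: pre_digraph.digraph_isomorphism_def with_proj_def)
    have V: "pverts H = ?f ` pverts G" and A: "parcs H = iso_arcs h ` parcs G"
      and T: "iso_tail h = fst" and D: "iso_head h = snd"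
      using H by (auto simp: with_proj_def app_iso_def)
    have arc: "iso_arcs h (x, y) = (?f x, ?f y)" if "(x, y) \<in> parcs G" for x y
      using tl[OF that] hd[OF that] T D by (simp add: prod_eq_iff)
    have "(x, y) \<in> parcs G \<longleftrightarrow> (?f x, ?f y) \<in> parcs H"
      if "x \<in> pverts G" "y \<in> pverts G" for x y
    proof
      assume "(x, y) \<in> parcs G"
      then show "(?f x, ?f y) \<in> parcs H" using arc A by force
    next
      assume "(?f x, ?f y) \<in> parcs H"
      then obtain u v where uv: "(u, v) \<in> parcs G" "(?f x, ?f y) = iso_arcs h (u, v)"
        using A by auto
      then have "u \<in> pverts G" "v \<in> pverts G"
        by (auto dest: G.in_arcsD1 G.in_arcsD2)
      then show "(x, y) \<in> parcs G"
        using uv arc[OF uv(1)] inj that by (auto dest: inj_onD)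
    qed
    then show "\<exists>f. bij_betw f (pverts G) (pverts H) \<and>
        (\<forall>x\<in>pverts G. \<forall>y\<in>pverts G. (x, y) \<in> parcs G \<longleftrightarrow> (f x, f y) \<in> parcs H)"
      using inj V by (auto simp: bij_betw_def intro!: exI[of _ ?f])
  next
    assume "\<exists>f. bij_betw f (pverts G) (pverts H) \<and>
        (\<forall>x\<in>pverts G. \<forall>y\<in>pverts G. (x, y) \<in> parcs G \<longleftrightarrow> (f x, f y) \<in> parcs H)"
    then obtain f where inj: "inj_on f (pverts G)" and V: "f ` pverts G = pverts H"
      and adj: "\<And>x y. x \<in> pverts G \<Longrightarrow> y \<in> pverts G \<Longrightarrow>
        (x, y) \<in> parcs G \<longleftrightarrow> (f x, f y) \<in> parcs H"
      by (auto simp: bij_betw_def)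
    define h where "h = \<lparr> iso_verts = f, iso_arcs = map_prod f f, iso_head = snd, iso_tail = fst \<rparr>"
    have arcs: "a \<in> pverts G \<times> pverts G" if "a \<in> parcs G" for a
      using that by (cases a) (auto dest: G.in_arcsD1 G.in_arcsD2)
    have "inj_on (map_prod f f) (parcs G)"
      by (rule inj_on_subset[OF map_prod_inj_on[OF inj inj]]) (use arcs in blast)
    then have iso: "pre_digraph.digraph_isomorphism (with_proj G) h"
      using inj G.wf_digraph
      by (auto simp: pre_digraph.digraph_isomorphism_def h_def with_proj_def)
    have "map_prod f f ` parcs G = parcs H"
    proof (intro equalityI subsetI)
      fix b assume "b \<in> map_prod f f ` parcs G"
      then obtain x y where xy: "(x, y) \<in> parcs G" "b = (f x, f y)" by auto
      then show "b \<in> parcs H" using arcs[OF xy(1)] adj[of x y] by simp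
    next
      fix b assume b: "b \<in> parcs H"
      then have "fst b \<in> f ` pverts G" "snd b \<in> f ` pverts G"
        using V H.arc_fst_in_verts H.arc_snd_in_verts by auto
      then obtain x y where xy: "b = (f x, f y)" "x \<in> pverts G" "y \<in> pverts G"
        by (metis imageE prod.collapse)
      then have "(x, y) \<in> parcs G" using adj[of x y] b by simp
      then have "map_prod f f (x, y) \<in> map_prod f f ` parcs G" by (rule imageI)
      then show "b \<in> map_prod f f ` parcs G" using xy(1) by simp
    qed
    then have "with_proj H = app_iso h (with_proj G)"
      using V by (simp add: app_iso_def h_def with_proj_def)
    then show "G \<cong>\<^sub>g H" using iso by (auto simp: digraph_iso_def)
  qed
qed

end

theory Submission
  imports Defs
begin

text \<open>
  An induced matching with $k$ edges forces $k$ colours in every representation: if the earlier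
  endpoints $x_i$, $x_j$ of two edges had the same colour, the later endpoint $y_i$ could not come
  after $x_j$, nor $y_j$ after $x_i$, so $x_i < y_i \<le> x_j < y_j \<le> x_i$. On the other hand the
  matching is the graph of a $k$-rainbow word of length $2k$. With $N = k 2^k$, the words of length
  $n$ which avoid this word at all positions divisible by $2k$ are exponentially rare among all
  $N^n$ words, whereas at least $N^{n - 2k}$ words have pairwise distinct graphs.
\<close>

lemma induced_matching_le_colours:
  assumes a: "\<And>x. x < n \<Longrightarrow> a x < c"
    and edge: "\<And>i. i < k \<Longrightarrow> (u i, v i) \<in> parcs (rainbow_graph n (a, e))"
    and induced: "\<And>i j. i < k \<Longrightarrow> j < k \<Longrightarrow> i \<noteq> j \<Longrightarrow>
      ({u i, v i} \<times> {u j, v j}) \<inter> parcs (rainbow_graph n (a, e)) = {}"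
  shows "k \<le> c"
proof -
  \<comment> \<open>The pair \<open>u i\<close>, \<open>v i\<close> comes in no fixed order, whereas
    adjacency reads the colour of the earlier vertex and the set of the later one; hence the
    sorting.\<close>
  define x where "x i = min (u i) (v i)" for i
  define y where "y i = max (u i) (v i)" for i
  have xy: "x i < y i" "y i < n" "a (x i) \<in> e (y i)" if "i < k" for i
    using edge[OF that] by (auto simp: x_def y_def rainbow_graph_def min_def max_def)
  have "inj_on (\<lambda>i. a (x i)) {..<k}"
  proof (rule inj_onI, rule ccontr)
    fix i j assume ij: "i \<in> {..<k}" "j \<in> {..<k}" "a (x i) = a (x j)" "i \<noteq> j"
    \<comment> \<open>If \<open>x j < y i\<close>, the common colour lies in \<open>e (y i)\<close>,
      so \<open>x j\<close> and \<open>y i\<close> are adjacent: an edge between two different edges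
      of an induced matching.\<close>
    have sep: "y i \<le> x j" if "i < k" "j < k" "a (x i) = a (x j)" "i \<noteq> j" for i j
    proof (rule ccontr)
      assume "\<not> y i \<le> x j"
      then have "(x j, y i) \<in> parcs (rainbow_graph n (a, e))"
        using xy[OF that(1)] that(3) rainbow_graph_adjacent_iff(1)[of "x j" "y i" n a e] by simp
      moreover have "(x j, y i) \<in> {u j, v j} \<times> {u i, v i}"
        by (auto simp: x_def y_def min_def max_def)
      ultimately show False using induced[of j i] that by blast
    qed
    show False using sep[of i j] sep[of j i] xy(1)[of i] xy(1)[of j] ij by simp
  qed
  moreover have "(\<lambda>i. a (x i)) ` {..<k} \<subseteq> {..<c}"
    using xy a by (fastforce dest: less_trans)
  ultimately have "card {..<k} \<le> card {..<c}" by (intro card_inj_on_le) auto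
  then show ?thesis by simp
qed

text \<open>A letter carries both the colour and the set of one vertex, so that a rainbow sequence
  becomes a single word that can be cut into blocks and counted.\<close>

definition letters :: "nat \<Rightarrow> (nat \<times> nat set) set" where
  "letters k = {..<k} \<times> Pow {..<k}"

lemma finite_letters [simp]: "finite (letters k)"
  by (simp add: letters_def)

lemma card_letters: "card (letters k) = k * 2 ^ k"
  by (simp add: letters_def card_Pow)

text \<open>Positions \<open>2 * i\<close> and \<open>2 * i + 1\<close> share the colour
  \<open>i\<close>. The even one accepts no earlier vertex; the odd one accepts the colour
  \<open>i\<close>, which within the word only its partner has before it.\<close>

definition matching_word :: "nat \<Rightarrow> nat \<Rightarrow> nat \<times> nat set" where
  "matching_word k = (\<lambda>r\<in>{..<2 * k}. (r div 2, if even r then {} else {r div 2}))"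

lemma matching_word_in: "matching_word k \<in> {..<2 * k} \<rightarrow>\<^sub>E letters k"
  by (auto simp: matching_word_def letters_def split: if_splits)

text \<open>Blocks start at multiples of \<open>m\<close>, so they are disjoint and can be filled
  independently.\<close>

definition block :: "nat \<Rightarrow> (nat \<Rightarrow> 'a) \<Rightarrow> nat \<Rightarrow> nat \<Rightarrow> 'a" where
  "block m s b = (\<lambda>r\<in>{..<m}. s (b * m + r))"

text \<open>Adjacency inside a block depends on its own letters only, so the block induces a
  matching with \<open>k\<close> edges. An isomorphism may scramble the vertex order, but the bound
  on colours holds for induced matchings in any order.\<close>

lemma matching_block_not_iso:
  assumes b: "b < n div (2 * k)"
    and block: "block (2 * k) (\<lambda>x. (a x, e x)) b = matching_word k"
    and H: "H \<in> rainbow_threshold_graphs c n" and iso: "rainbow_graph n (a, e) \<cong>\<^sub>g H"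
  shows "k \<le> c"
proof -
  let ?G = "rainbow_graph n (a, e)"
  obtain a' e' where H': "H = rainbow_graph n (a', e')" and a': "\<And>x. x < n \<Longrightarrow> a' x < c"
    using H by (auto simp: rainbow_threshold_graphs_def rainbow_sequences_def PiE_def Pi_def)
  have wf: "pair_wf_digraph (rainbow_graph n S)" for S
  proof -
    interpret pair_graph "rainbow_graph n S" by (rule rainbow_graph_pair_graph)
    show ?thesis by unfold_locales
  qed
  obtain f where f: "\<And>x y. x < n \<Longrightarrow> y < n \<Longrightarrow> (x, y) \<in> parcs ?G \<longleftrightarrow> (f x, f y) \<in> parcs H"
    using iso unfolding H' graph_iso_iff[OF wf wf] by (auto simp: rainbow_graph_def)
  define p where "p r = b * (2 * k) + r" for r
  have "Suc b * (2 * k) \<le> n"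
    using b by (metis Suc_leI div_times_less_eq_dividend le_trans mult_le_mono1)
  then have p: "p r < n" if "r < 2 * k" for r
    using that by (simp add: p_def)
  have word: "a (p r) = r div 2" "e (p r) = (if even r then {} else {r div 2})" if "r < 2 * k" for r
    using fun_cong[OF block, of r] that by (simp_all add: block_def matching_word_def p_def)
  have adj: "(p r, p s) \<in> parcs ?G \<longleftrightarrow> r \<noteq> s \<and> r div 2 = s div 2" if "r < 2 * k" "s < 2 * k" for r s
  proof -
    have "(p r, p s) \<in> parcs ?G \<longleftrightarrow>
        r < s \<and> odd s \<and> r div 2 = s div 2 \<or> s < r \<and> odd r \<and> r div 2 = s div 2"
      using that p word by (auto simp: rainbow_graph_def) (auto simp: p_def)
    \<comment> \<open>Of two distinct numbers with the same half, the larger is odd.\<close>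
    also have "\<dots> \<longleftrightarrow> r \<noteq> s \<and> r div 2 = s div 2" by presburger
    finally show ?thesis .
  qed
  have adj': "(f (p r), f (p s)) \<in> parcs H \<longleftrightarrow> r \<noteq> s \<and> r div 2 = s div 2"
    if "r < 2 * k" "s < 2 * k" for r s
    using adj[OF that] f[OF p p, OF that] by simp
  show ?thesis
    by (rule induced_matching_le_colours[OF a',
          where e = e' and u = "\<lambda>i. f (p (2 * i))" and v = "\<lambda>i. f (p (2 * i + 1))"])
       (auto simp: H'[symmetric] adj')
qed

text \<open>A word is determined by its \<open>n div m\<close> complete blocks, each with one
  forbidden value, and by a free remainder of length \<open>n mod m\<close>; \<open>F\<close>
  performs this cut.\<close>

lemma card_avoiding_words_le:
  fixes T :: "'a set"
  assumes "finite T" and w: "w \<in> {..<m} \<rightarrow>\<^sub>E T"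
  shows "card {s \<in> {..<n} \<rightarrow>\<^sub>E T. \<forall>b < n div m. block m s b \<noteq> w}
    \<le> (card T ^ m - 1) ^ (n div m) * card T ^ (n mod m)"
proof -
  let ?A = "{s \<in> {..<n} \<rightarrow>\<^sub>E T. \<forall>b < n div m. block m s b \<noteq> w}"
  let ?C = "({..<n div m} \<rightarrow>\<^sub>E (({..<m} \<rightarrow>\<^sub>E T) - {w})) \<times> ({..<n mod m} \<rightarrow>\<^sub>E T)"
  define F where "F s = (\<lambda>b\<in>{..<n div m}. block m s b, \<lambda>r\<in>{..<n mod m}. s (n div m * m + r))"
    for s :: "nat \<Rightarrow> 'a"
  have "inj_on F ?A"
  proof (rule inj_onI)
    fix s t assume s: "s \<in> ?A" and t: "t \<in> ?A" and eq: "F s = F t"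
    have "s x = t x" if x: "x < n" for x
    proof (cases "x < n div m * m")
      case True
      then have "m > 0" "x div m < n div m" by (auto simp: less_mult_imp_div_less intro: Nat.gr0I)
      moreover have "fst (F s) (x div m) (x mod m) = fst (F t) (x div m) (x mod m)"
        using eq by simp
      ultimately show ?thesis by (simp add: F_def block_def)
    next
      case False
      then have "x - n div m * m < n mod m"
        using x div_mult_mod_eq[of n m] by linarith
      moreover have "snd (F s) (x - n div m * m) = snd (F t) (x - n div m * m)"
        using eq by simp
      ultimately show ?thesis using False by (simp add: F_def)
    qed
    then show "s = t" using s t by (intro PiE_ext[of s "{..<n}" "\<lambda>_. T"]) auto
  qed
  moreover have "F ` ?A \<subseteq> ?C"
  proof (rule image_subsetI)
    fix s assume s: "s \<in> ?A"
    have "b * m + r < n" if "b < n div m" "r < m" for b r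
    proof -
      have "Suc b * m \<le> n"
        using that(1) by (metis Suc_leI div_times_less_eq_dividend le_trans mult_le_mono1)
      then show ?thesis using that(2) by simp
    qed
    moreover have "n div m * m + r < n" if "r < n mod m" for r
      using that div_mult_mod_eq[of n m] by linarith
    ultimately show "F s \<in> ?C"
      using s by (auto simp: F_def block_def PiE_def Pi_def)
  qed
  moreover have "finite ?C" using assms(1) by (auto intro!: finite_cartesian_product finite_PiE)
  ultimately have "card ?A \<le> card ?C" by (rule card_inj_on_le)
  also have "card ?C = (card T ^ m - 1) ^ (n div m) * card T ^ (n mod m)"
    using w by (simp add: card_cartesian_product card_funcsetE card_Diff_singleton)
  finally show ?thesis .
qed

text \<open>No word representing such a graph has the matching word as a block, since that would
  force \<open>k \<le> c\<close>. Choosing one word per graph, there are at most as many graphs as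
  avoiding words.\<close>

lemma card_iso_fewer_colours_le:
  assumes "c < k"
  shows "card {G \<in> rainbow_threshold_graphs k n. \<exists>H \<in> rainbow_threshold_graphs c n. G \<cong>\<^sub>g H}
    \<le> ((k * 2 ^ k) ^ (2 * k) - 1) ^ (n div (2 * k)) * (k * 2 ^ k) ^ (n mod (2 * k))"
    (is "card ?B \<le> ?R")
proof -
  let ?A = "{s \<in> {..<n} \<rightarrow>\<^sub>E letters k. \<forall>b < n div (2 * k). block (2 * k) s b \<noteq> matching_word k}"
  let ?g = "\<lambda>s. rainbow_graph n (\<lambda>x. fst (s x), \<lambda>x. snd (s x))"
  have fin: "finite ?A" by (simp add: finite_PiE)
  have "?B \<subseteq> ?g ` ?A"
  proof
    fix G assume "G \<in> ?B"
    then obtain a e H where G: "G = rainbow_graph n (a, e)"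
      and ae: "(a, e) \<in> rainbow_sequences k n"
      and H: "H \<in> rainbow_threshold_graphs c n" "G \<cong>\<^sub>g H"
      by (auto simp: rainbow_threshold_graphs_def)
    define s where "s = (\<lambda>x\<in>{..<n}. (a x, e x))"
    have "s \<in> {..<n} \<rightarrow>\<^sub>E letters k"
      using ae by (auto simp: s_def rainbow_sequences_def letters_def PiE_def Pi_def)
    moreover have G': "G = ?g s"
      by (auto simp: G s_def rainbow_graph_def)
    moreover have "block (2 * k) s b \<noteq> matching_word k" if "b < n div (2 * k)" for b
      using matching_block_not_iso[of b n k "\<lambda>x. fst (s x)" "\<lambda>x. snd (s x)" H c]
        that H assms by (auto simp: G')
    ultimately show "G \<in> ?g ` ?A" by blast
  qed
  then have "card ?B \<le> card (?g ` ?A)" using fin by (intro card_mono) auto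
  also have "\<dots> \<le> card ?A" by (rule card_image_le[OF fin])
  also have "\<dots> \<le> ?R"
    using card_avoiding_words_le[OF finite_letters matching_word_in] by (simp add: card_letters)
  finally show ?thesis .
qed

text \<open>
  Colours are read off the last $k$ vertices, whose sets are the singletons, and sets are read off
  the first $k$ vertices, whose colours are all different.
\<close>

lemma card_rainbow_threshold_graphs_ge:
  assumes "k \<ge> 1" "2 * k \<le> n"
  shows "(k * 2 ^ k) ^ (n - 2 * k) \<le> card (rainbow_threshold_graphs k n)"
proof -
  let ?W = "{..<n - 2 * k} \<rightarrow>\<^sub>E letters k"
  \<comment> \<open>The word \<open>s\<close> occupies the vertices from \<open>k\<close> to
    \<open>n - k - 1\<close>. The colour 0 of the last vertices and the empty sets of the first ones
    are fillers; 0 is a legal colour as \<open>k \<ge> 1\<close>.\<close>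
  define a where "a s = (\<lambda>x\<in>{..<n}. if x < k then x else if x < n - k then fst (s (x - k)) else 0)"
    for s :: "nat \<Rightarrow> nat \<times> nat set"
  define e where
    "e s = (\<lambda>y\<in>{..<n}. if y < k then {} else if y < n - k then snd (s (y - k)) else {y - (n - k)})"
    for s :: "nat \<Rightarrow> nat \<times> nat set"
  define g where "g s = rainbow_graph n (a s, e s)" for s
  have W: "fst (s p) < k" "snd (s p) \<subseteq> {..<k}" if "s \<in> ?W" "p < n - 2 * k" for s p
    using PiE_mem[OF that(1), of p] that(2) by (auto simp: letters_def mem_Times_iff)
  have sets: "(i, k + p) \<in> parcs (g s) \<longleftrightarrow> i \<in> snd (s p)" if "i < k" "p < n - 2 * k" for s i p
    using that rainbow_graph_adjacent_iff(1)[of i "k + p" n "a s" "e s"]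
    by (auto simp: g_def a_def e_def)
  have cols: "(k + p, n - k + i) \<in> parcs (g s) \<longleftrightarrow> fst (s p) = i" if "i < k" "p < n - 2 * k" for s i p
  proof -
    have "k + p < n - k" "n - k + i < n" using that by linarith+
    then have "a s (k + p) = fst (s p)" "e s (n - k + i) = {i}" by (auto simp: a_def e_def)
    then show ?thesis
      using rainbow_graph_adjacent_iff(1)[of "k + p" "n - k + i" n "a s" "e s"]
        \<open>k + p < n - k\<close> \<open>n - k + i < n\<close> by (simp add: g_def)
  qed
  have "inj_on g ?W"
  proof (rule inj_onI)
    fix s t assume s: "s \<in> ?W" and t: "t \<in> ?W" and eq: "g s = g t"
    have "s p = t p" if p: "p < n - 2 * k" for p
    proof (rule prod_eqI)
      show "fst (s p) = fst (t p)"
        \<comment> \<open>Both graphs are tested at the final vertex whose singleton is the colour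
          of \<open>t p\<close>.\<close>
        using cols[OF W(1)[OF t p] p, of s] cols[OF W(1)[OF t p] p, of t] eq by simp
      show "snd (s p) = snd (t p)"
        using sets[OF _ p, of _ s] sets[OF _ p, of _ t] eq W(2)[OF s p] W(2)[OF t p] by auto
    qed
    then show "s = t" using s t by (intro PiE_ext[of s "{..<n - 2 * k}" "\<lambda>_. letters k"]) auto
  qed
  moreover have "g ` ?W \<subseteq> rainbow_threshold_graphs k n"
  proof (rule image_subsetI)
    fix s assume s: "s \<in> ?W"
    have "a s \<in> {..<n} \<rightarrow>\<^sub>E {..<k}" using W(1)[OF s] assms by (auto simp: a_def)
    moreover have "e s \<in> {..<n} \<rightarrow>\<^sub>E Pow {..<k}"
    proof (rule PiE_I)
      fix y assume "y \<in> {..<n}"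
      then show "e s y \<in> Pow {..<k}" using W(2)[OF s, of "y - k"] assms by (auto simp: e_def)
    qed (simp add: e_def)
    ultimately show "g s \<in> rainbow_threshold_graphs k n"
      by (simp add: g_def rainbow_threshold_graphs_def rainbow_sequences_def)
  qed
  ultimately have "card ?W \<le> card (rainbow_threshold_graphs k n)"
    by (intro card_inj_on_le finite_rainbow_threshold_graphs)
  then show ?thesis by (simp add: card_funcsetE card_letters)
qed

theorem corollary3p13:
  fixes k :: nat
  assumes "k \<ge> 1"
  shows "(\<lambda>n. real (card {G \<in> rainbow_threshold_graphs k n.
                       \<exists>H \<in> rainbow_threshold_graphs (k - 1) n. G \<cong>\<^sub>g H})
              / real (card (rainbow_threshold_graphs k n))) \<longlonglongrightarrow> 0"
    (is "(\<lambda>n. real (?num n) / real (?den n)) \<longlonglongrightarrow> 0")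
proof -
  define m where "m = 2 * k"
  define N where "N = k * 2 ^ k"
  \<comment> \<open>The proportion of words of length \<open>m\<close> that differ from the matching
    word.\<close>
  define q where "q = 1 - 1 / real N ^ m"
  have m: "m > 0" and N: "N \<ge> 1" using assms by (simp_all add: m_def N_def)
  then have Nm: "real N ^ m \<ge> 1" by simp
  have q: "0 \<le> q" "q < 1" using Nm N by (simp_all add: q_def)
  \<comment> \<open>The factor \<open>real N ^ m\<close> pays for the \<open>m\<close> vertices that
    the lower bound on the denominator spends on decoding; it does not grow with
    \<open>n\<close>.\<close>
  have bound: "real (?num n) / real (?den n) \<le> real N ^ m * q ^ (n div m)" if n: "m \<le> n" for n
  proof -
    have num: "real (?num n) \<le> (real N ^ m - 1) ^ (n div m) * real N ^ (n mod m)"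
    proof -
      have "real (?num n) \<le> real ((N ^ m - 1) ^ (n div m) * N ^ (n mod m))"
        using card_iso_fewer_colours_le[of "k - 1" k n] assms
        by (intro of_nat_mono) (simp add: m_def N_def)
      \<comment> \<open>Truncated subtraction is harmless because \<open>N ^ m\<close> is at least
        1.\<close>
      also have "\<dots> = (real N ^ m - 1) ^ (n div m) * real N ^ (n mod m)"
        using N by (simp add: of_nat_diff)
      finally show ?thesis .
    qed
    have den: "real N ^ (n - m) \<le> real (?den n)"
      using card_rainbow_threshold_graphs_ge[OF assms, of n] n
      unfolding m_def N_def of_nat_power[symmetric] by (simp only: of_nat_le_iff)
    have "real (?num n) / real (?den n)
        \<le> (real N ^ m - 1) ^ (n div m) * real N ^ (n mod m) / real N ^ (n - m)"
      using num den N Nm by (intro frac_le) auto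
    also have "\<dots> = real N ^ m * ((real N ^ m - 1) ^ (n div m) * real N ^ (n mod m) / real N ^ n)"
      using n N by (simp add: power_diff)
    \<comment> \<open>Splitting \<open>n\<close> like the words lets the factor of the incomplete
      block cancel.\<close>
    also have "real N ^ n = (real N ^ m) ^ (n div m) * real N ^ (n mod m)"
      by (metis mult_div_mod_eq power_add power_mult)
    also have "(real N ^ m - 1) ^ (n div m) * real N ^ (n mod m) / \<dots> = q ^ (n div m)"
      using N by (simp add: q_def diff_divide_distrib flip: power_divide)
    finally show ?thesis .
  qed
  have "filterlim (\<lambda>n. n div m) at_top at_top"
    using m by (rule filterlim_at_top_div_const_nat)
  then have "(\<lambda>n. q ^ (n div m)) \<longlonglongrightarrow> 0"
    using filterlim_compose[OF LIMSEQ_realpow_zero[OF q]] by blast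
  then have "(\<lambda>n. real N ^ m * q ^ (n div m)) \<longlonglongrightarrow> 0"
    by (rule tendsto_mult_right_zero)
  then show ?thesis
  proof (rule tendsto_sandwich[OF _ _ tendsto_const, rotated 2])
    show "\<forall>\<^sub>F n in sequentially. real (?num n) / real (?den n) \<le> real N ^ m * q ^ (n div m)"
      using bound by (rule eventually_sequentiallyI)
    show "\<forall>\<^sub>F n in sequentially. 0 \<le> real (?num n) / real (?den n)"
      by simp
  qed
qed

end
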